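(* Let $\phi=\frac{1+\sqrt5}{2}$. Then $$\operatorname{Li}_2\left(\frac{\sqrt{\phi}+1}{\phi^2}\right)+\operatorname{Li}_2\left(\phi^3-\phi^{5/2}\right)=\frac{17\pi^2}{60}-\ln\left(\phi^{5/2}-2\phi\right)\ln\left(\phi^{7/2}-\phi^3\right)-\frac12\ln\left(\phi^{7/2}-\phi^3\right)\ln\left(\phi^{11/2}+2\phi^{7/2}+\phi^6+\phi^4\right)-\frac{11}{8}\ln^2(\phi).$$
   Context: $\operatorname{Li}_2(z)=\sum_{k\ge1}z^k/k^2$ for $|z|\le 1$ is the dilogarithm; $\ln$ is the natural logarithm and $\ln^2(y)=(\ln y)^2$. *)

theory Defs
  imports "HOL-Analysis.Analysis"
begin

(* The index is shifted (k = n + 1); the series converges exactly for norm z <= 1,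
   and the value is only meaningful there. *)
definition dilog :: "'a :: {real_normed_field, banach} \<Rightarrow> 'a" where
  "dilog z = (\<Sum>n. z ^ Suc n / of_nat (Suc n) ^ 2)"

end

theory Submission
  imports Defs "HOL-Real_Asymp.Real_Asymp"
begin

text \<open>Put \<open>s = sqrt \<phi>\<close>, so that \<open>s^4 = s^2 + 1\<close> and \<open>(s - 1) (s + 1) s^2 = 1\<close>. The two arguments are
  \<open>(s + 1) / s^4\<close> and \<open>s^3 / (s + 1)\<close>, with product \<open>1 / s\<close>, and the five-term relation turns the
  left-hand side into \<open>Li(1/s) + Li(s/(s + 1)) + Li(1/\<phi>^2)\<close> plus logarithms. Reflection, Landen's
  identity and the duplication formula reduce the first two summands to \<open>Li(1/\<phi>) / 2\<close>, and the same
  three identities determine \<open>Li(1/\<phi>)\<close> and \<open>Li(1/\<phi>^2)\<close>. All arguments of logarithms are products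
  of powers of \<open>s\<close> and \<open>s + 1\<close>.\<close>

section \<open>Continuity and derivative of the dilogarithm series\<close>

lemma dilog_0 [simp]: "dilog (0 :: real) = 0"
  by (simp add: dilog_def)

lemma dilog_1: "dilog (1 :: real) = pi\<^sup>2 / 6"
  using inverse_squares_sums by (simp add: dilog_def sums_iff add.commute)

text \<open>The closed interval matters: the functional equations below are proved by
  differentiation inside an interval, and their constants come from the endpoints by
  continuity.\<close>

lemma continuous_on_dilog: "continuous_on {-1..1} (dilog :: real \<Rightarrow> real)"
proof -
  have "uniform_limit {-1..1::real} (\<lambda>n x. \<Sum>i<n. x ^ Suc i / real (Suc i) ^ 2)
          (\<lambda>x. \<Sum>i. x ^ Suc i / real (Suc i) ^ 2) sequentially"
  proof (rule Weierstrass_m_test)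
    fix n :: nat and x :: real
    assume "x \<in> {-1..1}"
    then have "\<bar>x\<bar> ^ Suc n \<le> 1"
      by (intro power_le_one) auto
    then show "norm (x ^ Suc n / real (Suc n) ^ 2) \<le> 1 / real (n + 1) ^ 2"
      by (simp add: power_abs abs_mult divide_right_mono)
  next
    show "summable (\<lambda>n. 1 / real (n + 1) ^ 2)"
      using inverse_squares_sums by (simp add: sums_iff)
  qed
  then have "continuous_on {-1..1} (\<lambda>x::real. \<Sum>i. x ^ Suc i / real (Suc i) ^ 2)"
    by (rule uniform_limit_theorem[rotated]) (auto intro!: always_eventually continuous_intros)
  then show ?thesis
    by (simp add: dilog_def [abs_def])
qed

lemma continuous_on_dilog_compose:
  fixes f :: "'a :: topological_space \<Rightarrow> real"
  assumes "continuous_on S f" "\<And>x. x \<in> S \<Longrightarrow> \<bar>f x\<bar> \<le> 1"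
  shows "continuous_on S (\<lambda>x. dilog (f x))"
  by (rule continuous_on_compose2[OF continuous_on_dilog assms(1)])
     (use assms(2) in \<open>force simp: abs_le_iff\<close>)

text \<open>Termwise differentiation leaves the logarithm series divided by \<open>x\<close>. The
  point 0 is excluded because the closed form evaluates to 0 there, while the derivative is
  1.\<close>

lemma has_real_derivative_dilog:
  fixes x :: real
  assumes "\<bar>x\<bar> < 1" "x \<noteq> 0"
  shows "(dilog has_real_derivative - ln (1 - x) / x) (at x)"
proof -
  have sums: "(\<lambda>n. y ^ n / real (Suc n)) sums (- ln (1 - y) / y)" if "\<bar>y\<bar> < 1" "y \<noteq> 0" for y :: real
  proof -
    have "(\<lambda>n. - (y ^ n) / real n) sums ln (1 - y)"
      using ln_series'[of "- y"] that by simp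
    \<comment> \<open>The dropped term at index 0 has denominator 0, hence value 0, so the shift
      keeps the sum.\<close>
    then have "(\<lambda>n. - (y ^ Suc n) / real (Suc n)) sums ln (1 - y)"
      by (subst sums_Suc_iff) simp
    from sums_mult[OF this, of "- 1 / y"] show ?thesis
      using that by simp
  qed
  have "((\<lambda>x. \<Sum>n. 1 / real (Suc n) ^ 2 * x ^ Suc n) has_real_derivative
      (\<Sum>n. 1 / real (Suc n) ^ 2 * real (Suc n) * x ^ n)) (at x)"
  proof (rule DERIV_power_series'[where R = 1])
    fix y :: real
    assume y: "y \<in> {-1<..<1}"
    show "summable (\<lambda>n. 1 / real (Suc n) ^ 2 * real (Suc n) * y ^ n)"
    proof (cases "y = 0")
      case False
      with y sums[of y] show ?thesis
        by (auto simp: sums_iff power2_eq_square abs_less_iff)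
    qed (auto intro: summable_finite[of "{0}"])
  qed (use assms in auto)
  then show ?thesis
    using sums[OF assms] by (simp add: sums_iff power2_eq_square dilog_def [abs_def])
qed

lemma has_real_derivative_dilog_compose [derivative_intros]:
  fixes f :: "real \<Rightarrow> real"
  assumes "(f has_real_derivative f') (at x within S)" "\<bar>f x\<bar> < 1" "f x \<noteq> 0"
  shows "((\<lambda>x. dilog (f x)) has_real_derivative - ln (1 - f x) / f x * f') (at x within S)"
  using DERIV_chain2[OF has_real_derivative_dilog[OF assms(2,3)] assms(1)] .

section \<open>Functional equations and values at the golden ratio\<close>

lemma dilog_reflection:
  fixes x :: real
  assumes "0 < x" "x < 1"
  shows "dilog x + dilog (1 - x) = pi\<^sup>2 / 6 - ln x * ln (1 - x)"
proof -
  define f where "f t = dilog t + dilog (1 - t) + ln t * ln (1 - t)" for t :: real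
  have "(f has_real_derivative 0) (at t within {0<..<1})" if "t \<in> {0<..<1}" for t
    unfolding f_def using that
    by (auto intro!: derivative_eq_intros simp: divide_simps)
  then have "\<exists>c. \<forall>t\<in>{0<..<1}. f t = c"
    by (intro has_field_derivative_zero_constant) auto
  then obtain c where c: "\<And>t. 0 < t \<Longrightarrow> t < 1 \<Longrightarrow> f t = c"
    by auto
  have cont: "continuous_on {0..1} (\<lambda>t::real. dilog t + dilog (1 - t))"
    by (intro continuous_intros continuous_on_dilog_compose) auto
  \<comment> \<open>The constant is read off as t tends to 0 from the right. The dilogarithms are
    continuous there; the product of logarithms needs a separate limit.\<close>
  have "((\<lambda>t::real. dilog t + dilog (1 - t)) \<longlongrightarrow> dilog 0 + dilog (1 - 0)) (at_right 0)"
    using continuous_on_Icc_at_rightD[OF cont] by simp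
  moreover have "((\<lambda>t::real. ln t * ln (1 - t)) \<longlongrightarrow> 0) (at_right 0)"
    by real_asymp
  ultimately have "(f \<longlongrightarrow> dilog 0 + dilog (1 - 0) + 0) (at_right 0)"
    unfolding f_def by (rule tendsto_add)
  moreover have "eventually (\<lambda>t. f t = c) (at_right 0)"
    using eventually_at_right_real[OF zero_less_one] by eventually_elim (auto simp: c)
  then have "(f \<longlongrightarrow> c) (at_right 0)"
    by (rule tendsto_eventually)
  ultimately have "c = dilog 1"
    using tendsto_unique[of "at_right (0::real)"] by force
  with c[OF assms] show ?thesis
    by (simp add: f_def dilog_1)
qed

text \<open>The factorization of 1 - t^2 splits its logarithm, so the difference of the two sides
  has derivative 0 inside the interval; at t = 0 it vanishes.\<close>

lemma dilog_duplication:
  fixes x :: real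
  assumes "0 < x" "x < 1"
  shows "dilog (x\<^sup>2) = 2 * (dilog x + dilog (- x))"
proof -
  define f where "f t = dilog (t\<^sup>2) - 2 * (dilog t + dilog (- t))" for t :: real
  have "f x = f 0"
  proof (rule DERIV_isconst2[OF assms(1)])
    show "continuous_on {0..x} f"
      unfolding f_def using assms
      by (intro continuous_intros continuous_on_dilog_compose) (auto intro!: power_le_one)
    fix t assume t: "0 < t" "t < x"
    then have "t\<^sup>2 < 1"
      using assms by (simp add: power_less_one_iff abs_square_less_1)
    moreover have "ln (1 - t\<^sup>2) = ln (1 - t) + ln (1 + t)"
    proof -
      have "1 - t\<^sup>2 = (1 - t) * (1 + t)"
        by (simp add: algebra_simps power2_eq_square)
      with t assms show ?thesis
        by (simp add: ln_mult)
    qed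
    ultimately show "(f has_real_derivative 0) (at t)"
      unfolding f_def using t assms
      by (auto intro!: derivative_eq_intros simp: divide_simps)
         (simp add: algebra_simps power2_eq_square)
  qed (use assms in auto)
  then show ?thesis
    by (simp add: f_def)
qed

text \<open>Both dilogarithms differentiate to rational multiples of ln (1 + t), since 1 - t / (1 +
  t) = 1 / (1 + t); the squared logarithm cancels what remains.\<close>

lemma dilog_landen:
  fixes x :: real
  assumes "0 < x" "x < 1"
  shows "dilog (- x) + dilog (x / (1 + x)) = - (ln (1 + x))\<^sup>2 / 2"
proof -
  define f where "f t = dilog (- t) + dilog (t / (1 + t)) + (ln (1 + t))\<^sup>2 / 2" for t :: real
  have "f x = f 0"
  proof (rule DERIV_isconst2[OF assms(1)])
    show "continuous_on {0..x} f"
      unfolding f_def using assms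
      by (intro continuous_intros continuous_on_dilog_compose) auto
    fix t assume t: "0 < t" "t < x"
    have "1 - t / (1 + t) = inverse (1 + t)"
      using t by (simp add: field_simps)
    then have "ln (1 - t / (1 + t)) = - ln (1 + t)"
      using t by (simp add: ln_inverse)
    then show "(f has_real_derivative 0) (at t)"
      unfolding f_def using t assms
      by (auto intro!: derivative_eq_intros simp: divide_simps)
         (simp add: algebra_simps power2_eq_square)
  qed (use assms in auto)
  then show ?thesis
    by (simp add: f_def)
qed

text \<open>Fix \<open>y\<close> and differentiate in the first variable. At 0 both sides reduce to
  \<open>dilog y\<close>.\<close>

lemma dilog_five_term:
  fixes x y :: real
  assumes x: "0 < x" "x < 1" and y: "0 < y" "y < 1"
  shows "dilog x + dilog y = dilog (x * y) + dilog (x * (1 - y) / (1 - x * y))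
           + dilog (y * (1 - x) / (1 - x * y))
           + (ln (1 - x) - ln (1 - x * y)) * (ln (1 - y) - ln (1 - x * y))"
proof -
  define f where "f t = dilog t + dilog y - dilog (t * y) - dilog (t * (1 - y) / (1 - t * y))
           - dilog (y * (1 - t) / (1 - t * y))
           - (ln (1 - t) - ln (1 - t * y)) * (ln (1 - y) - ln (1 - t * y))" for t :: real
  have ty: "t * y < t" "t * y < y" "t * y < 1" if "0 < t" "t < 1" for t :: real
  proof -
    show "t * y < t" "t * y < y"
      using that y by simp_all
    then show "t * y < 1"
      using y by linarith
  qed
  have "f x = f 0"
  proof (rule DERIV_isconst2[OF x(1)])
    have "\<bar>t * y\<bar> \<le> 1" "1 - t * y > 0" "1 - t > 0" "\<bar>t * (1 - y) / (1 - t * y)\<bar> \<le> 1"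
      "\<bar>y * (1 - t) / (1 - t * y)\<bar> \<le> 1" if "t \<in> {0..x}" for t
    proof -
      have "t * y \<le> y" "t * y \<le> t" "0 \<le> t * y"
        using that x y by (auto simp: mult_left_le mult_left_le_one_le)
      with that x y show "\<bar>t * y\<bar> \<le> 1" "1 - t * y > 0" "1 - t > 0"
        "\<bar>t * (1 - y) / (1 - t * y)\<bar> \<le> 1" "\<bar>y * (1 - t) / (1 - t * y)\<bar> \<le> 1"
        by (auto simp: abs_le_iff divide_simps algebra_simps)
    qed
    note b = this
    show "continuous_on {0..x} f"
      unfolding f_def
      by (intro continuous_intros continuous_on_dilog_compose) (use b x y in force)+
    fix t assume "0 < t" "t < x"
    then have t: "0 < t" "t < 1"
      using x by auto
    note p = ty[OF t]
    define d where "d = 1 - t * y"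
    have d: "0 < d"
      using p by (simp add: d_def)
    let ?P = "t * (1 - y) / (1 - t * y)" and ?Q = "y * (1 - t) / (1 - t * y)"
    \<comment> \<open>Both complements factor, so only ln (1 - t), ln (1 - y) and ln d occur in the
      derivatives.\<close>
    have P: "1 - ?P = (1 - t) / (1 - t * y)" and Q: "1 - ?Q = (1 - y) / (1 - t * y)"
      using p by (simp_all add: field_simps)
    have lnP: "ln (1 - ?P) = ln (1 - t) - ln d" and lnQ: "ln (1 - ?Q) = ln (1 - y) - ln d"
      unfolding P Q d_def using t y p by (simp_all add: ln_div)
    have "0 < ?P" "0 < ?Q" "0 < 1 - ?P" "0 < 1 - ?Q"
      unfolding P Q using t y p by simp_all
    then have PQ: "\<bar>?P\<bar> < 1" "?P \<noteq> 0" "\<bar>?Q\<bar> < 1" "?Q \<noteq> 0"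
      by linarith+
    have "((\<lambda>t. t * (1 - y) / (1 - t * y)) has_real_derivative (1 - y) / d\<^sup>2) (at t)"
      using d by (auto simp: d_def power2_eq_square algebra_simps intro!: derivative_eq_intros)
    from has_real_derivative_dilog_compose[OF this PQ(1,2)]
    have dP: "((\<lambda>t. dilog (t * (1 - y) / (1 - t * y))) has_real_derivative
        - (ln (1 - t) - ln d) * (1 / t + y / d)) (at t)"
    proof (rule DERIV_cong)
      \<comment> \<open>The left side is the logarithmic derivative of \<open>?P\<close>, split into
        partial fractions. The analogous \<open>eq\<close> below is minus that of
        \<open>?Q\<close>.\<close>
      have "1 / t + y / d = (1 - y) / d\<^sup>2 / ?P"
        using t y d by (simp add: divide_simps flip: d_def) (simp add: d_def algebra_simps power2_eq_square)
      then show "- ln (1 - ?P) / ?P * ((1 - y) / d\<^sup>2) = - (ln (1 - t) - ln d) * (1 / t + y / d)"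
        unfolding lnP by simp
    qed
    have "((\<lambda>t. y * (1 - t) / (1 - t * y)) has_real_derivative - y * (1 - y) / d\<^sup>2) (at t)"
      using d by (auto simp: d_def power2_eq_square algebra_simps intro!: derivative_eq_intros)
    from has_real_derivative_dilog_compose[OF this PQ(3,4)]
    have dQ: "((\<lambda>t. dilog (y * (1 - t) / (1 - t * y))) has_real_derivative
        (ln (1 - y) - ln d) * (1 / (1 - t) - y / d)) (at t)"
    proof (rule DERIV_cong)
      have eq: "1 / (1 - t) - y / d = y * (1 - y) / d\<^sup>2 / ?Q"
        using t y d by (simp add: divide_simps flip: d_def) (simp add: d_def algebra_simps power2_eq_square)
      have gen: "- l / q * (- y * (1 - y) / e) = l * (y * (1 - y) / e / q)" for l q e :: real
        by simp
      show "- ln (1 - ?Q) / ?Q * (- y * (1 - y) / d\<^sup>2) = (ln (1 - y) - ln d) * (1 / (1 - t) - y / d)"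
        unfolding lnQ eq using gen .
    qed
    have dt: "(dilog has_real_derivative - ln (1 - t) * (1 / t)) (at t)"
      using has_real_derivative_dilog[of t] t by simp
    have dty: "((\<lambda>t. dilog (t * y)) has_real_derivative - ln d * (1 / t)) (at t)"
      using t y p by (auto intro!: derivative_eq_intros simp: d_def abs_less_iff less_imp_neq)
    have dl: "((\<lambda>t. (ln (1 - t) - ln (1 - t * y)) * (ln (1 - y) - ln (1 - t * y))) has_real_derivative
        - (1 / (1 - t) - y / d) * (ln (1 - y) - ln d) + (y / d) * (ln (1 - t) - ln d)) (at t)"
      using t d by (auto intro!: derivative_eq_intros simp: d_def)
    have "(f has_real_derivative
        - ln (1 - t) * (1 / t) + 0 - (- ln d * (1 / t)) - (- (ln (1 - t) - ln d) * (1 / t + y / d))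
        - (ln (1 - y) - ln d) * (1 / (1 - t) - y / d)
        - (- (1 / (1 - t) - y / d) * (ln (1 - y) - ln d) + (y / d) * (ln (1 - t) - ln d))) (at t)"
      unfolding f_def by (intro DERIV_diff DERIV_add dP dQ dt dty dl DERIV_const)
    \<comment> \<open>The terms cancel formally, with the logarithms, 1 / t, 1 / (1 - t) and y / d
      as independent quantities.\<close>
    then show "(f has_real_derivative 0) (at t)"
      by (rule DERIV_cong) algebra
  qed (use x in auto)
  then show ?thesis
    by (simp add: f_def)
qed

text \<open>At x = 1 / \<phi> the numbers 1 - x, x / (1 + x) and x^2 coincide. Reflection, Landen
  and duplication thus become three linear equations for the values at x, -x and x^2.\<close>

lemma dilog_golden_ratio:
  fixes \<phi> :: real
  assumes pos: "0 < \<phi>" and sq: "\<phi>\<^sup>2 = \<phi> + 1"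
  shows "dilog (1 / \<phi>) = pi\<^sup>2 / 10 - (ln \<phi>)\<^sup>2" "dilog (1 / \<phi>\<^sup>2) = pi\<^sup>2 / 15 - (ln \<phi>)\<^sup>2"
proof -
  have "1 < \<phi>"
  proof (rule ccontr)
    assume "\<not> 1 < \<phi>"
    then have "\<phi>\<^sup>2 \<le> 1"
      using pos by (simp add: power_le_one)
    then show False
      using sq pos by simp
  qed
  then have p: "0 < 1 / \<phi>" "1 / \<phi> < 1"
    by simp_all
  have e: "1 - 1 / \<phi> = 1 / \<phi>\<^sup>2" "1 / \<phi> / \<phi> = 1 / \<phi>\<^sup>2" "1 + 1 / \<phi> = \<phi>"
    "(1 / \<phi>)\<^sup>2 = 1 / \<phi>\<^sup>2"
    using pos sq by (simp_all add: field_simps power2_eq_square)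
  have l: "ln (1 / \<phi>) = - ln \<phi>" "ln (1 / \<phi>\<^sup>2) = - 2 * ln \<phi>"
    using pos by (simp_all add: ln_div ln_realpow)
  have "dilog (1 / \<phi>) + dilog (1 / \<phi>\<^sup>2) = pi\<^sup>2 / 6 - 2 * (ln \<phi>)\<^sup>2"
    using dilog_reflection[OF p] unfolding e l by (simp add: power2_eq_square)
  moreover have "dilog (- (1 / \<phi>)) + dilog (1 / \<phi>\<^sup>2) = - (ln \<phi>)\<^sup>2 / 2"
    using dilog_landen[OF p] unfolding e .
  moreover have "dilog (1 / \<phi>\<^sup>2) = 2 * (dilog (1 / \<phi>) + dilog (- (1 / \<phi>)))"
    using dilog_duplication[OF p] unfolding e .
  ultimately show "dilog (1 / \<phi>) = pi\<^sup>2 / 10 - (ln \<phi>)\<^sup>2" "dilog (1 / \<phi>\<^sup>2) = pi\<^sup>2 / 15 - (ln \<phi>)\<^sup>2"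
    by (simp_all add: field_simps)
qed

section \<open>Reduction to \<open>s\<close> and the final evaluation\<close>

theorem theorem11:
  fixes \<phi> :: real
  assumes "\<phi> = (1 + sqrt 5) / 2"
  shows "dilog ((sqrt \<phi> + 1) / \<phi> ^ 2) + dilog (\<phi> ^ 3 - \<phi> powr (5/2)) =
      17 * pi ^ 2 / 60
      - ln (\<phi> powr (5/2) - 2 * \<phi>) * ln (\<phi> powr (7/2) - \<phi> ^ 3)
      - 1/2 * ln (\<phi> powr (7/2) - \<phi> ^ 3) * ln (\<phi> powr (11/2) + 2 * \<phi> powr (7/2) + \<phi> ^ 6 + \<phi> ^ 4)
      - 11/8 * (ln \<phi>) ^ 2"
proof -
  define s where "s = sqrt \<phi>"
  \<comment> \<open>Every logarithm in the claim becomes an integer combination of \<open>L\<close>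
    and \<open>M\<close>, so the final comparison is a polynomial identity in \<open>pi\<close>,
    \<open>L\<close>, \<open>M\<close>.\<close>
  define L M where "L = ln s" and "M = ln (s + 1)"
  have "1 < \<phi>"
    unfolding assms by (simp add: less_divide_eq real_less_rsqrt)
  moreover have sq: "\<phi>\<^sup>2 = \<phi> + 1"
    unfolding assms by (simp add: field_simps power2_eq_square)
  ultimately have s: "1 < s" and \<phi>: "\<phi> = s\<^sup>2"
    by (simp_all add: s_def)
  have s4: "s ^ 4 = s\<^sup>2 + 1"
    using sq by (simp add: \<phi>)
  have powr: "\<phi> powr (real n / 2) = s ^ n" for n
    using s by (simp add: \<phi> powr_powr powr_realpow flip: powr_numeral)
  have powrs: "\<phi> powr (5/2) = s ^ 5" "\<phi> powr (7/2) = s ^ 7" "\<phi> powr (11/2) = s ^ 11"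
    using powr[of 5] powr[of 7] powr[of 11] by simp_all
  define a b where "a = (s + 1) / s ^ 4" and "b = s ^ 3 / (s + 1)"
  have a_eq: "(sqrt \<phi> + 1) / \<phi> ^ 2 = a" 
    using s by (simp add: a_def \<phi>)
  \<comment> \<open>The difference is s^5 (s - 1), and s - 1 = 1 / (s^2 (s + 1)).\<close>
  have b_eq: "\<phi> ^ 3 - \<phi> powr (5/2) = b"
    unfolding powrs unfolding b_def \<phi> using s by (simp add: divide_simps) (use s4 in algebra)
  have ab: "a * b = 1 / s"
    unfolding a_def b_def using s by (simp add: divide_simps eval_nat_numeral)
  \<comment> \<open>Each of the next three complements has a factor s - 1, replaced as for
    \<open>b\<close>. The resulting forms show \<open>a\<close> and \<open>b\<close> to be below 1
    and give the logarithms at once.\<close>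
  have 1: "1 - a = 1 / (s ^ 5 * (s + 1))" 
    unfolding a_def using s by (simp add: divide_simps) (use s4 in algebra)
  have 2: "1 - b = 1 / (s ^ 3 * (s + 1)\<^sup>2)"
    unfolding b_def using s by (simp add: divide_simps) (use s4 in algebra)
  have 3: "1 - a * b = 1 / (s ^ 3 * (s + 1))"
    unfolding ab using s by (simp add: divide_simps) (use s4 in algebra)
  have "0 < a" "0 < b" "0 < 1 - a" "0 < 1 - b"
    unfolding 1 2 using s by (simp_all add: a_def b_def)
  then have bounds: "0 < a" "a < 1" "0 < b" "b < 1"
    by simp_all
  have 4: "a * (1 - b) / (1 - a * b) = 1 / \<phi>\<^sup>2"
    unfolding 2 3 unfolding a_def \<phi> using s by (simp add: divide_simps) algebra
  \<comment> \<open>The value is s / (s + 1), written as the complement of u / (1 + u) for u = 1 / s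
    so that reflection and then Landen apply.\<close>
  have 5: "b * (1 - a) / (1 - a * b) = 1 - 1 / s / (1 + 1 / s)"
    unfolding 1 3 unfolding b_def using s by (simp add: divide_simps) algebra
  have ln_ab: "ln (1 - a) = - 5 * L - M" "ln (1 - b) = - 3 * L - 2 * M" "ln (1 - a * b) = - 3 * L - M"
    unfolding 1 2 3 L_def M_def using s by (simp_all add: ln_div ln_mult ln_realpow)
  have five: "dilog a + dilog b = dilog (1 / s) + dilog (1 / \<phi>\<^sup>2)
      + dilog (1 - 1 / s / (1 + 1 / s)) + 2 * L * M"
    using dilog_five_term[OF bounds] unfolding 4 5 unfolding ab ln_ab[unfolded ab]
    by (simp add: algebra_simps)

  \<comment> \<open>Subtracting Landen at \<open>u\<close> from reflection at u / (1 + u) trades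
    \<open>dilog (1 - u / (1 + u))\<close> for \<open>dilog (- u)\<close>. Together with
    \<open>dilog u\<close> this is half of \<open>dilog (u\<^sup>2)\<close>, and u^2 = 1 /
    \<phi>.\<close>
  define u where "u = 1 / s"
  have u: "0 < u" "u < 1" "0 < u / (1 + u)" "u / (1 + u) < 1"
    using s by (simp_all add: u_def field_simps)
  have uv: "1 + u = (s + 1) / s" "u / ((s + 1) / s) = 1 / (s + 1)" "1 - 1 / (s + 1) = s / (s + 1)"
    using s by (simp_all add: u_def field_simps)
  have ln_u: "ln (u / (1 + u)) = - M" "ln (1 - u / (1 + u)) = L - M" "ln (1 + u) = M - L"
    unfolding uv L_def M_def using s by (simp_all add: ln_div)
  have ln_\<phi>: "ln \<phi> = 2 * L"
    unfolding \<phi> L_def using s by (simp add: ln_realpow)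
  have "u\<^sup>2 = 1 / \<phi>"
    by (simp add: u_def \<phi> power_divide)
  then have "2 * (dilog u + dilog (- u)) = pi\<^sup>2 / 10 - 4 * L\<^sup>2"
    using dilog_duplication[OF u(1,2)] dilog_golden_ratio(1)[of \<phi>] \<open>1 < \<phi>\<close> sq
    by (simp add: ln_\<phi> power_mult_distrib)
  moreover have "dilog (u / (1 + u)) + dilog (1 - u / (1 + u)) = pi\<^sup>2 / 6 + M * (L - M)"
    using dilog_reflection[OF u(3,4)] by (simp add: ln_u)
  moreover have "dilog (- u) + dilog (u / (1 + u)) = - (M - L)\<^sup>2 / 2"
    using dilog_landen[OF u(1,2)] by (simp add: ln_u)
  moreover have "dilog (1 / \<phi>\<^sup>2) = pi\<^sup>2 / 15 - 4 * L\<^sup>2"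
    using dilog_golden_ratio(2)[of \<phi>] \<open>1 < \<phi>\<close> sq by (simp add: ln_\<phi> power_mult_distrib)
  ultimately have lhs: "dilog a + dilog b = 17 * pi\<^sup>2 / 60 - 11/2 * L\<^sup>2 + 2 * L * M - M\<^sup>2 / 2"
    using five unfolding u_def[symmetric] by (simp add: power2_eq_square algebra_simps)

  \<comment> \<open>This number is 1 - b, because s^6 = 2 s^2 + 1.\<close>
  have "\<phi> powr (5/2) - 2 * \<phi> = 1 / (s ^ 3 * (s + 1)\<^sup>2)"
    unfolding powrs unfolding \<phi> using s by (simp add: divide_simps) (use s4 in algebra)
  then have l1: "ln (\<phi> powr (5/2) - 2 * \<phi>) = - 3 * L - 2 * M"
    unfolding L_def M_def using s by (simp add: ln_div ln_mult ln_realpow)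
  have "\<phi> powr (7/2) - \<phi> ^ 3 = s ^ 4 / (s + 1)"
    unfolding powrs unfolding \<phi> using s by (simp add: divide_simps) (use s4 in algebra)
  then have l2: "ln (\<phi> powr (7/2) - \<phi> ^ 3) = 4 * L - M"
    unfolding L_def M_def using s by (simp add: ln_div ln_mult ln_realpow)
  \<comment> \<open>After s^6 is taken out, s^6 = 2 s^2 + 1 and s^5 = s^3 + s turn the cofactor into
    the expanded cube of s + 1.\<close>
  have "\<phi> powr (11/2) + 2 * \<phi> powr (7/2) + \<phi> ^ 6 + \<phi> ^ 4 = s ^ 6 * (s + 1) ^ 3"
    unfolding powrs unfolding \<phi> using s4 by algebra
  then have l3: "ln (\<phi> powr (11/2) + 2 * \<phi> powr (7/2) + \<phi> ^ 6 + \<phi> ^ 4) = 6 * L + 3 * M"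
    unfolding L_def M_def using s by (simp add: ln_mult ln_realpow)
  show ?thesis
    unfolding a_eq b_eq lhs l1 l2 l3 ln_\<phi> by (simp add: power2_eq_square algebra_simps)
qed

end
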